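(* Let $L(\lambda)=\lambda M+K\in\mathbb{R}^{2n\times2n}[\lambda]$ be a regular real $T$-SHH pencil, let $0\le m_1\le m_2\le p$ be integers with $2m_1+2p<2n$, and let $X_c\in\mathbb{R}^{2n\times(2m_1+2p)}$ and $\Lambda_c,\Lambda_a\in\mathbb{R}^{(2m_1+2p)\times(2m_1+2p)}$ be the matrices built from eigenpairs of $L(\lambda)$ and from the aimed eigenvalues as described in the context. Let $(X_c,\Lambda_c)$ and $(X_f,\Lambda_f)$ be complementary deflating pairs of $L(\lambda)$. Suppose that (a) $\sigma(\Lambda_c)\cap\sigma(-\Lambda_f^T)=\emptyset$, (b) $G:=X_c^TJMX_c$ is nonsingular, and that all the eigenvalues to be changed (the eigenvalues of $\Lambda_c$) are distinct. Put $U:=JMX_cG^{-1}$ and, for a matrix $\hat M$ of size $(2m_1+2p)\times(2m_1+2p)$, $$\Delta M=J^TU\hat MU^T,\qquad \Delta K=J^TU\left(G\Lambda_c-(G+\hat M)\Lambda_a\right)U^T.$$ Then for arbitrary $\hat M$ the pairs $(X_c,\Lambda_a)$ and $(X_f,\Lambda_f)$ are complementary deflating pairs of $L_\Delta(\lambda)=\lambda(M+\Delta M)+(K+\Delta K)$. In addition, choosing $$\hat M=\mathrm{diag}(\hat M_1,\dots,\hat M_{m_1},\hat M_{m_1+1},\dots,\hat M_{m_2},\hat M_{m_2+1},\dots,\hat M_p)$$ with $$\hat M_j=\begin{bmatrix}\mathbf{0}&\alpha_jI_2+\beta_jJ_2\\-\alpha_jI_2+\beta_jJ_2&\mathbf{0}\end{bmatrix},\qquad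 \hat M_k=\beta_kJ_2,\qquad \hat M_l=\beta_lJ_2,$$ where $\mathbf{0}$ is the zero matrix, $J_2=\begin{bmatrix}0&1\\-1&0\end{bmatrix}$, and $\alpha_j,\beta_j,\beta_k,\beta_l$ are arbitrary real numbers $(j=1,\dots,m_1;\ k=m_1+1,\dots,m_2;\ l=m_2+1,\dots,p)$, the matrix $\Delta M$ is $T$-skew-Hamiltonian and $\Delta K$ is $T$-Hamiltonian.
   Context: $J=\begin{bmatrix}0&I_n\\-I_n&0\end{bmatrix}$. A matrix $A\in\mathbb{C}^{2n\times2n}$ is $T$-skew-Hamiltonian if $(JA)^T=-JA$ and $T$-Hamiltonian if $(JA)^T=JA$; a pencil $\lambda M+K$ is $T$-SHH ($T$-skew-Hamiltonian/Hamiltonian) if $M$ is $T$-skew-Hamiltonian and $K$ is $T$-Hamiltonian. A pencil is regular if $\det(\lambda M+K)$ is not the zero polynomial. A deflating pair of a pencil $\lambda M+K\in\mathbb{C}^{N\times N}[\lambda]$ is a matrix pair $(X,\Lambda)\in\mathbb{C}^{N\times q}\times\mathbb{C}^{q\times q}$ with $\operatorname{rank}X=q\le N$ and $MX\Lambda+KX=0$. Two deflating pairs $(X_1,\Lambda_1)$, $(X_2,\Lambda_2)$ are complementary if $[X_1\ X_2]$ is a nonsingular square matrix. $\sigma(\Lambda)$ is the spectrum of $\Lambda$. Throughout, $j\in\{1,\dots,m_1\}$, $k\in\{m_1+1,\dots,m_2\}$, $l\in\{m_2+1,\dots,p\}$. Eigenvalues of $L(\lambda)$ to be changed: quadruples $(\lambda_j^c,\overline{\lambda_j^c},-\overline{\lambda_j^c},-\lambda_j^c)$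 are to be replaced by $(\lambda_j^a,\overline{\lambda_j^a},-\overline{\lambda_j^a},-\lambda_j^a)$, where $\lambda_j^c,\lambda_j^a$ have nonzero real and nonzero imaginary parts; pairs $(\lambda_k^c,\overline{\lambda_k^c})$ are to be replaced by $(\lambda_k^a,\overline{\lambda_k^a})$, where $\lambda_k^c,\lambda_k^a$ have zero real parts; pairs $(\lambda_l^c,-\lambda_l^c)$ are to be replaced by $(\lambda_l^a,-\lambda_l^a)$, where $\lambda_l^c,\lambda_l^a$ have zero imaginary parts. Let $x_j^c,\hat x_j^c$ be eigenvectors for $\lambda_j^c,-\overline{\lambda_j^c}$; $x_k^c$ an eigenvector for $\lambda_k^c$; and $x_l^c,\hat x_l^c$ (real) eigenvectors for $\lambda_l^c,-\lambda_l^c$. Set $X_c=[X_1^c\ \cdots\ X_p^c]$ with $X_j^c=[\mathrm{re}(x_j^c)\ \mathrm{im}(x_j^c)\ \mathrm{re}(\hat x_j^c)\ \mathrm{im}(\hat x_j^c)]$, $X_k^c=[\mathrm{re}(x_k^c)\ \mathrm{im}(x_k^c)]$, $X_l^c=[x_l^c\ \hat x_l^c]$. For $s\in\{c,a\}$ set $\Lambda_s=\mathrm{diag}(\Lambda_1^s,\dots,\Lambda_p^s)$ with $$\Lambda_j^s=\mathrm{diag}(\hat\Lambda_j^s,-(\hat\Lambda_j^s)^T),\quad \hat\Lambda_j^s=\begin{bmatrix}\mathrm{re}(\lambda_j^s)&\mathrm{im}(\lambda_j^s)\\-\mathrm{im}(\lambda_j^s)&\mathrm{re}(\lambda_j^s)\end{bmatrix},\quad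 \Lambda_k^s=\begin{bmatrix}0&\mathrm{im}(\lambda_k^s)\\-\mathrm{im}(\lambda_k^s)&0\end{bmatrix},\quad \Lambda_l^s=\mathrm{diag}(\lambda_l^s,-\lambda_l^s).$$ *)

theory Defs
  imports
    "Jordan_Normal_Form.Spectral_Radius"
    "Jordan_Normal_Form.DL_Rank"
begin

text \<open>
  All matrices have complex entries; a real matrix is a complex matrix whose entries lie
  in \<^term>\<open>\<real> :: complex set\<close>. The pencil \<open>\<lambda> M + K\<close> is represented by the two matrices \<open>M\<close> and \<open>K\<close>.
\<close>

definition real_mat :: "complex mat \<Rightarrow> bool" where
  "real_mat A \<longleftrightarrow> elements_mat A \<subseteq> \<real>"

definition real_vec :: "complex vec \<Rightarrow> bool" where
  "real_vec v \<longleftrightarrow> (\<forall>i < dim_vec v. v $ i \<in> \<real>)"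

definition re_vec :: "complex vec \<Rightarrow> complex vec" where
  "re_vec = map_vec (\<lambda>z. complex_of_real (Re z))"

definition im_vec :: "complex vec \<Rightarrow> complex vec" where
  "im_vec = map_vec (\<lambda>z. complex_of_real (Im z))"

definition J_mat :: "nat \<Rightarrow> complex mat" where
  "J_mat n = four_block_mat (0\<^sub>m n n) (1\<^sub>m n) (- 1\<^sub>m n) (0\<^sub>m n n)"

definition T_skew_Hamiltonian :: "nat \<Rightarrow> complex mat \<Rightarrow> bool" where
  "T_skew_Hamiltonian n A \<longleftrightarrow>
     A \<in> carrier_mat (2*n) (2*n) \<and> transpose_mat (J_mat n * A) = - (J_mat n * A)"

definition T_Hamiltonian :: "nat \<Rightarrow> complex mat \<Rightarrow> bool" where
  "T_Hamiltonian n A \<longleftrightarrow>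
     A \<in> carrier_mat (2*n) (2*n) \<and> transpose_mat (J_mat n * A) = J_mat n * A"

definition T_SHH_pencil :: "nat \<Rightarrow> complex mat \<Rightarrow> complex mat \<Rightarrow> bool" where
  "T_SHH_pencil n M K \<longleftrightarrow> T_skew_Hamiltonian n M \<and> T_Hamiltonian n K"

definition regular_pencil :: "complex mat \<Rightarrow> complex mat \<Rightarrow> bool" where
  "regular_pencil M K \<longleftrightarrow>
     det ([:0, 1:] \<cdot>\<^sub>m map_mat (\<lambda>c. [:c:]) M + map_mat (\<lambda>c. [:c:]) K) \<noteq> 0"

definition pencil_eigenpair ::
  "nat \<Rightarrow> complex mat \<Rightarrow> complex mat \<Rightarrow> complex \<Rightarrow> complex vec \<Rightarrow> bool" where
  "pencil_eigenpair N M K \<mu> v \<longleftrightarrow>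
     v \<in> carrier_vec N \<and> v \<noteq> 0\<^sub>v N \<and> (\<mu> \<cdot>\<^sub>m M + K) *\<^sub>v v = 0\<^sub>v N"

definition deflating_pair ::
  "nat \<Rightarrow> complex mat \<Rightarrow> complex mat \<Rightarrow> complex mat \<Rightarrow> complex mat \<Rightarrow> bool" where
  "deflating_pair N M K X \<Lambda> \<longleftrightarrow>
     (\<exists>q \<le> N. X \<in> carrier_mat N q \<and> \<Lambda> \<in> carrier_mat q q \<and>
        vec_space.rank N X = q \<and> M * X * \<Lambda> + K * X = 0\<^sub>m N q)"

definition complementary_deflating_pairs ::
  "nat \<Rightarrow> complex mat \<Rightarrow> complex mat \<Rightarrow> complex mat \<Rightarrow> complex mat \<Rightarrow>
     complex mat \<Rightarrow> complex mat \<Rightarrow> bool" where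
  "complementary_deflating_pairs N M K X\<^sub>1 \<Lambda>\<^sub>1 X\<^sub>2 \<Lambda>\<^sub>2 \<longleftrightarrow>
     deflating_pair N M K X\<^sub>1 \<Lambda>\<^sub>1 \<and> deflating_pair N M K X\<^sub>2 \<Lambda>\<^sub>2 \<and>
     invertible_mat (mat_of_cols N (cols X\<^sub>1 @ cols X\<^sub>2))"


text \<open>
  Index ranges: \<open>j \<in> {1..m1}\<close> (quadruples), \<open>k \<in> {m1+1..m2}\<close> (purely imaginary pairs),
  \<open>l \<in> {m2+1..p}\<close> (real pairs). Values outside \<open>{1..p}\<close> are never used.
\<close>

definition three_ranges ::
  "nat \<Rightarrow> nat \<Rightarrow> nat \<Rightarrow> (nat \<Rightarrow> 'b) \<Rightarrow> (nat \<Rightarrow> 'b) \<Rightarrow> (nat \<Rightarrow> 'b) \<Rightarrow> 'b list" where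
  "three_ranges m1 m2 p f g h =
     map f [1..<m1+1] @ map g [m1+1..<m2+1] @ map h [m2+1..<p+1]"

definition eigenvalue_list :: "nat \<Rightarrow> nat \<Rightarrow> nat \<Rightarrow> (nat \<Rightarrow> complex) \<Rightarrow> complex list" where
  "eigenvalue_list m1 m2 p \<mu> = concat (three_ranges m1 m2 p
     (\<lambda>j. [\<mu> j, cnj (\<mu> j), - cnj (\<mu> j), - \<mu> j])
     (\<lambda>k. [\<mu> k, cnj (\<mu> k)])
     (\<lambda>l. [\<mu> l, - \<mu> l]))"

definition X_mat ::
  "nat \<Rightarrow> nat \<Rightarrow> nat \<Rightarrow> nat \<Rightarrow> (nat \<Rightarrow> complex vec) \<Rightarrow> (nat \<Rightarrow> complex vec) \<Rightarrow> complex mat" where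
  "X_mat N m1 m2 p x xh = mat_of_cols N (concat (three_ranges m1 m2 p
     (\<lambda>j. [re_vec (x j), im_vec (x j), re_vec (xh j), im_vec (xh j)])
     (\<lambda>k. [re_vec (x k), im_vec (x k)])
     (\<lambda>l. [x l, xh l])))"

definition Lambda_hat :: "complex \<Rightarrow> complex mat" where
  "Lambda_hat z = map_mat complex_of_real
     (mat_of_rows_list 2 [[Re z, Im z], [- Im z, Re z]])"

definition Lambda_mat :: "nat \<Rightarrow> nat \<Rightarrow> nat \<Rightarrow> (nat \<Rightarrow> complex) \<Rightarrow> complex mat" where
  "Lambda_mat m1 m2 p \<mu> = diag_block_mat (three_ranges m1 m2 p
     (\<lambda>j. diag_block_mat [Lambda_hat (\<mu> j), - transpose_mat (Lambda_hat (\<mu> j))])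
     (\<lambda>k. map_mat complex_of_real (mat_of_rows_list 2 [[0, Im (\<mu> k)], [- Im (\<mu> k), 0]]))
     (\<lambda>l. mat_of_rows_list 2 [[\<mu> l, 0], [0, - \<mu> l]]))"


definition G_mat :: "nat \<Rightarrow> complex mat \<Rightarrow> complex mat \<Rightarrow> complex mat" where
  "G_mat n M X = transpose_mat X * J_mat n * M * X"

text \<open>The inverse is only meaningful when \<^term>\<open>invertible_mat (G_mat n M X)\<close> holds.\<close>

definition U_mat :: "nat \<Rightarrow> complex mat \<Rightarrow> complex mat \<Rightarrow> complex mat" where
  "U_mat n M X = J_mat n * M * X * the (mat_inverse (G_mat n M X))"

definition Delta_M :: "nat \<Rightarrow> complex mat \<Rightarrow> complex mat \<Rightarrow> complex mat \<Rightarrow> complex mat" where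
  "Delta_M n M X Mh =
     transpose_mat (J_mat n) * U_mat n M X * Mh * transpose_mat (U_mat n M X)"

definition Delta_K ::
  "nat \<Rightarrow> complex mat \<Rightarrow> complex mat \<Rightarrow> complex mat \<Rightarrow> complex mat \<Rightarrow> complex mat \<Rightarrow> complex mat"
where
  "Delta_K n M X \<Lambda>c \<Lambda>a Mh =
     transpose_mat (J_mat n) * U_mat n M X *
       (G_mat n M X * \<Lambda>c - (G_mat n M X + Mh) * \<Lambda>a) * transpose_mat (U_mat n M X)"

definition M_hat :: "nat \<Rightarrow> nat \<Rightarrow> nat \<Rightarrow> (nat \<Rightarrow> real) \<Rightarrow> (nat \<Rightarrow> real) \<Rightarrow> complex mat" where
  "M_hat m1 m2 p \<alpha> \<beta> = diag_block_mat (three_ranges m1 m2 p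
     (\<lambda>j. four_block_mat
        (0\<^sub>m 2 2)
        (complex_of_real (\<alpha> j) \<cdot>\<^sub>m 1\<^sub>m 2 + complex_of_real (\<beta> j) \<cdot>\<^sub>m J_mat 1)
        (- complex_of_real (\<alpha> j) \<cdot>\<^sub>m 1\<^sub>m 2 + complex_of_real (\<beta> j) \<cdot>\<^sub>m J_mat 1)
        (0\<^sub>m 2 2))
     (\<lambda>k. complex_of_real (\<beta> k) \<cdot>\<^sub>m J_mat 1)
     (\<lambda>l. complex_of_real (\<beta> l) \<cdot>\<^sub>m J_mat 1))"

end

theory Submission
  imports Defs
begin

text \<open>
  Write \<open>S = J M\<close>, which is skew-symmetric, and \<open>H = J K\<close>, which is symmetric, so that
  \<open>G = X\<^sup>T S X\<close> and \<open>U = S X G\<inverse>\<close>, where \<open>X\<close> is \<open>X\<^sub>c\<close>.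

  \<^bold>\<open>Deflating pairs.\<close> Both updates act through \<open>U\<^sup>T\<close>, and \<open>U\<close> is dual to the pair \<open>(X, X\<^sub>f)\<close>:
  \<open>U\<^sup>T X = I\<close> and \<open>U\<^sup>T X\<^sub>f = 0\<close>. The second identity holds because \<open>Z = X\<^sup>T S X\<^sub>f\<close> satisfies the
  Sylvester equation \<open>\<Lambda>\<^sub>c\<^sup>T Z + Z \<Lambda>\<^sub>f = 0\<close>, obtained by pairing each deflation equation with the other
  basis; the condition on the spectra leaves only \<open>Z = 0\<close> (\<open>sylvester_homogeneous_trivial\<close>,
  \<open>U_complement\<close>). So the updated pencil agrees with the old one on \<open>X\<^sub>f\<close>, while on \<open>X\<close> the identity
  \<open>J\<^sup>T U G = M X\<close> makes the terms with \<open>\<Lambda>\<^sub>a\<close> cancel and leaves \<open>M X \<Lambda>\<^sub>c + K X = 0\<close>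
  (\<open>updated_pair_deflates\<close>).

  \<^bold>\<open>Structure.\<close> Since \<open>J \<Delta>M = U Mh U\<^sup>T\<close> and \<open>J \<Delta>K = U (G \<Lambda>\<^sub>c - (G + Mh) \<Lambda>\<^sub>a) U\<^sup>T\<close>, it is enough that \<open>Mh\<close> is
  skew-symmetric and that \<open>G \<Lambda>\<^sub>c\<close>, \<open>G \<Lambda>\<^sub>a\<close> and \<open>Mh \<Lambda>\<^sub>a\<close> are symmetric. The claims on \<open>Mh\<close> are checked block
  by block, and \<open>G \<Lambda>\<^sub>c = - X\<^sup>T H X\<close> is symmetric. The point is \<open>G \<Lambda>\<^sub>a\<close>. As \<open>G\<close> is skew-symmetric, symmetry
  of \<open>G \<Lambda>\<close> means that \<open>\<Lambda>\<close> is skew-adjoint for \<open>G\<close>: \<open>\<Lambda>\<^sup>T G + G \<Lambda> = 0\<close>. The matrices \<open>\<Lambda>\<^sub>c\<close> and \<open>\<Lambda>\<^sub>a\<close> have a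
  common eigenbasis \<open>P\<close>: the blocks of real pairs are diagonal, and all others are built from matrices
  \<open>[a, b; - b, a]\<close>, each of which has the eigenvectors \<open>(1, \<i>)\<close> and \<open>(1, - \<i>)\<close>. In that basis skew-adjointness says \<open>(d\<^sub>u + d\<^sub>v) (P\<^sup>T G P)\<^sub>u\<^sub>v = 0\<close> for the eigenvalues \<open>d\<close>. The current
  eigenvalues are distinct, so \<open>d\<^sub>u + d\<^sub>v = 0\<close> happens only if \<open>v\<close> is the position in the block of \<open>u\<close> that
  carries the negated eigenvalue, and at these two positions the aimed eigenvalues are negatives of
  each other too. Hence skew-adjointness passes from \<open>\<Lambda>\<^sub>c\<close> to \<open>\<Lambda>\<^sub>a\<close>
  (\<open>skew_adjoint_transfer\<close>, \<open>Lambda_mat_skew_adjoint_transfer\<close>).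
\<close>

section \<open>Matrix algebra\<close>

text \<open>
  In this form, where all dimensions are read off the factors, reassociation and transposition of
  long products can be left to the simplifier; in the versions with carrier sets the dimensions do not
  occur in the left-hand side and have to be guessed.
\<close>

lemma mult_mat_assoc:
  fixes A :: "'a :: semiring_0 mat"
  assumes "dim_col A = dim_row B" and "dim_col B = dim_row C"
  shows "A * B * C = A * (B * C)"
  using assms by (intro assoc_mult_mat[of A "dim_row A" "dim_row B" B "dim_row C" C "dim_col C"]) auto

lemma mult_carrier_mat_iff:
  "A * B \<in> carrier_mat nr nc \<longleftrightarrow> dim_row A = nr \<and> dim_col B = nc"
  unfolding carrier_mat_def by simp

lemma transpose_mult_dim:
  fixes A :: "'a :: comm_semiring_0 mat"
  assumes "dim_col A = dim_row B"
  shows "transpose_mat (A * B) = transpose_mat B * transpose_mat A"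
  using assms by (intro transpose_mult[of A "dim_row A" "dim_row B" B "dim_col B"]) auto

lemma mat_inverse_invertible:
  fixes A :: "'a :: field mat"
  assumes A: "A \<in> carrier_mat n n" and inv: "invertible_mat A"
  shows "the (mat_inverse A) \<in> carrier_mat n n"
    and "A * the (mat_inverse A) = 1\<^sub>m n" and "the (mat_inverse A) * A = 1\<^sub>m n"
proof -
  from inv obtain B where AB: "A * B = 1\<^sub>m (dim_row A)" and BA: "B * A = 1\<^sub>m (dim_row B)"
    unfolding invertible_mat_def inverts_mat_def by auto
  have "dim_col (A * B) = dim_row A" "dim_col (B * A) = dim_row B" unfolding AB BA by auto
  with A have B: "B \<in> carrier_mat n n" by auto
  have "A \<in> Units (ring_mat TYPE('a) n ())"
    unfolding Units_def using A B AB BA by (auto simp: ring_mat_simps)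
  with mat_inverse(1)[OF A] obtain C where "mat_inverse A = Some C" by fastforce
  with mat_inverse(2)[OF A this]
  show "the (mat_inverse A) \<in> carrier_mat n n"
    and "A * the (mat_inverse A) = 1\<^sub>m n" and "the (mat_inverse A) * A = 1\<^sub>m n"
    by auto
qed

text \<open>
  A Schur decomposition \<open>B = P T Q\<close> turns the equation into \<open>A W = W T\<close> for \<open>W = Z P\<close> with \<open>T\<close> upper
  triangular. Once the columns before the \<open>j\<close>-th are known to vanish, the \<open>j\<close>-th column of the
  equation reads \<open>A w = T\<^sub>j\<^sub>j w\<close>; as \<open>T\<^sub>j\<^sub>j\<close> is an eigenvalue of \<open>B\<close> it is none of \<open>A\<close>, so \<open>w = 0\<close>.
\<close>

lemma sylvester_homogeneous_trivial:
  fixes A B Z :: "complex mat"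
  assumes A: "A \<in> carrier_mat m m" and B: "B \<in> carrier_mat k k" and Z: "Z \<in> carrier_mat m k"
    and eq: "A * Z = Z * B"
    and disj: "spectrum A \<inter> spectrum B = {}"
  shows "Z = 0\<^sub>m m k"
proof -
  obtain es where cp: "char_poly B = (\<Prod>a\<leftarrow>es. [:- a, 1:])"
    using char_poly_factorized[OF B] by auto
  obtain T P Q where "schur_decomposition B es = (T, P, Q)"
    by (cases "schur_decomposition B es") auto
  from schur_decomposition[OF B cp this]
  have sim: "similar_mat_wit B T P Q" and tri: "upper_triangular T" and diag: "diag_mat T = es"
    by auto
  note s = similar_mat_witD2[OF B sim]
  define W where "W = Z * P"
  have W: "W \<in> carrier_mat m k" using Z s unfolding W_def by auto
  have AW: "A * W = W * T"
  proof -
    have "A * W = A * Z * P" unfolding W_def using A Z s by (simp add: assoc_mult_mat)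
    also have "\<dots> = Z * (P * T * Q) * P" unfolding eq by (simp add: s(3)[symmetric])
    also have "\<dots> = Z * P * T * (Q * P)" using Z s(4-) by (simp add: mult_mat_assoc)
    also have "\<dots> = W * T" unfolding s(2) W_def using Z s(4-) by (simp add: mult_mat_assoc)
    finally show ?thesis .
  qed
  have spec: "T $$ (j,j) \<in> spectrum B" if "j < k" for j
  proof -
    have "T $$ (j,j) \<in> set es" unfolding diag[symmetric] diag_mat_def using that s(5) by auto
    hence "poly (char_poly B) (T $$ (j,j)) = 0"
      unfolding cp poly_prod_list by (auto simp: prod_list_zero_iff)
    thus ?thesis unfolding spectrum_root_char_poly[OF B] by auto
  qed
  have col0: "col W j = 0\<^sub>v m" if "j < k" for j
    using that
  proof (induction j rule: less_induct)
    case (less j)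
    have W0: "W $$ (i,l) = 0" if "i < m" "l < j" for i l
      using less.IH[OF that(2)] less.prems that W
      by (metis carrier_matD(1,2) dual_order.strict_trans index_col index_zero_vec(1))
    have "A *\<^sub>v col W j = col (W * T) j" using A W less.prems AW by (metis carrier_matD(2) col_mult2)
    also have "\<dots> = T $$ (j,j) \<cdot>\<^sub>v col W j"
    proof (rule eq_vecI)
      fix i assume "i < dim_vec (T $$ (j,j) \<cdot>\<^sub>v col W j)"
      hence i: "i < m" using W by auto
      have "col (W * T) j $ i = (\<Sum>l<k. W $$ (i,l) * T $$ (l,j))"
        using i less.prems W s(5) by (auto simp: scalar_prod_def atLeast0LessThan)
      also have "\<dots> = (\<Sum>l<k. if l = j then W $$ (i,j) * T $$ (j,j) else 0)"
      proof (rule sum.cong[OF refl])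
        fix l assume "l \<in> {..<k}"
        thus "W $$ (i,l) * T $$ (l,j) = (if l = j then W $$ (i,j) * T $$ (j,j) else 0)"
          using W0[OF i, of l] upper_triangularD[OF tri, of j l] s(5)
          by (cases l j rule: linorder_cases) auto
      qed
      also have "\<dots> = (T $$ (j,j) \<cdot>\<^sub>v col W j) $ i" using i less.prems W by simp
      finally show "col (W * T) j $ i = (T $$ (j,j) \<cdot>\<^sub>v col W j) $ i" .
    qed (use W s(5) in auto)
    finally have ev: "A *\<^sub>v col W j = T $$ (j,j) \<cdot>\<^sub>v col W j" .
    show ?case
    proof (rule ccontr)
      assume "col W j \<noteq> 0\<^sub>v m"
      with ev have "eigenvector A (col W j) (T $$ (j,j))"
        unfolding eigenvector_def using A W by auto
      hence "T $$ (j,j) \<in> spectrum A" unfolding spectrum_def eigenvalue_def by auto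
      with spec[OF less.prems] disj show False by auto
    qed
  qed
  have "W = 0\<^sub>m m k" by (rule mat_col_eqI) (use W col0 in auto)
  moreover have "Z = W * Q" unfolding W_def using Z s(4-) s(1) by (simp add: mult_mat_assoc)
  ultimately show ?thesis using s(7) by simp
qed

section \<open>Block diagonal matrices\<close>

lemma diag_block_mat_carrier:
  assumes "\<And>x. x \<in> set xs \<Longrightarrow> F x \<in> carrier_mat (s x) (s x)"
  shows "diag_block_mat (map F xs) \<in> carrier_mat (sum_list (map s xs)) (sum_list (map s xs))"
proof -
  have "map dim_row (map F xs) = map s xs" "map dim_col (map F xs) = map s xs"
    using assms by auto
  thus ?thesis by (intro carrier_matI) (simp_all only: dim_diag_block_mat)
qed

lemma diag_block_mat_mult:
  fixes F H :: "'b \<Rightarrow> 'a :: semiring_0 mat"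
  assumes "\<And>x. x \<in> set xs \<Longrightarrow> F x \<in> carrier_mat (s x) (s x)"
    and "\<And>x. x \<in> set xs \<Longrightarrow> H x \<in> carrier_mat (s x) (s x)"
  shows "diag_block_mat (map F xs) * diag_block_mat (map H xs)
       = diag_block_mat (map (\<lambda>x. F x * H x) xs)"
  using assms
proof (induction xs)
  case (Cons x xs)
  let ?S = "sum_list (map s xs)"
  let ?F = "diag_block_mat (map F xs)" and ?H = "diag_block_mat (map H xs)"
  have c: "F x \<in> carrier_mat (s x) (s x)" "H x \<in> carrier_mat (s x) (s x)" using Cons.prems by auto
  have C: "?F \<in> carrier_mat ?S ?S" "?H \<in> carrier_mat ?S ?S"
    using Cons.prems by (auto intro!: diag_block_mat_carrier)
  have d: "dim_row ?F = ?S" "dim_col ?F = ?S" "dim_row ?H = ?S" "dim_col ?H = ?S"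
    "dim_row (F x) = s x" "dim_col (F x) = s x" "dim_row (H x) = s x" "dim_col (H x) = s x"
    using c C by auto
  have IH: "diag_block_mat (map (\<lambda>x. F x * H x) xs) = ?F * ?H" using Cons by auto
  show ?case
    by (simp add: Let_def d IH,
        subst mult_four_block_mat[OF c(1) zero_carrier_mat zero_carrier_mat C(1)
            c(2) zero_carrier_mat zero_carrier_mat C(2)],
        use c C in simp)
qed simp

lemma diag_block_mat_transpose:
  assumes "\<And>x. x \<in> set xs \<Longrightarrow> F x \<in> carrier_mat (s x) (s x)"
  shows "transpose_mat (diag_block_mat (map F xs)) = diag_block_mat (map (\<lambda>x. transpose_mat (F x)) xs)"
  using assms
proof (induction xs)
  case (Cons x xs)
  let ?S = "sum_list (map s xs)"
  let ?F = "diag_block_mat (map F xs)"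
  have c: "F x \<in> carrier_mat (s x) (s x)" using Cons.prems by auto
  have C: "?F \<in> carrier_mat ?S ?S" using Cons.prems by (auto intro!: diag_block_mat_carrier)
  have d: "dim_row ?F = ?S" "dim_col ?F = ?S" "dim_row (F x) = s x" "dim_col (F x) = s x"
    using c C by auto
  have IH: "diag_block_mat (map (\<lambda>x. transpose_mat (F x)) xs) = transpose_mat ?F"
    using Cons by auto
  show ?case
    by (simp add: Let_def d IH,
        subst transpose_four_block_mat[OF c zero_carrier_mat zero_carrier_mat C]) simp
qed (simp add: eq_matI)

lemma diag_block_mat_uminus:
  fixes F :: "'b \<Rightarrow> 'a :: group_add mat"
  shows "diag_block_mat (map (\<lambda>x. - F x) xs) = - diag_block_mat (map F xs)"
proof (induction xs)
  case (Cons x xs)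
  show ?case by (intro eq_matI) (auto simp: Let_def Cons)
qed auto

lemma diag_block_mat_one:
  "diag_block_mat (map (\<lambda>x. 1\<^sub>m (s x)) xs) = 1\<^sub>m (sum_list (map s xs))"
  by (induction xs) (auto simp: Let_def)

definition diag_of_list :: "'a :: zero list \<Rightarrow> 'a mat" where
  "diag_of_list ds = mat_diag (length ds) (\<lambda>i. ds ! i)"

lemma diag_of_list_carrier[simp]: "diag_of_list ds \<in> carrier_mat (length ds) (length ds)"
  unfolding diag_of_list_def by simp

lemma diag_of_list_append:
  "four_block_mat (diag_of_list a) (0\<^sub>m (length a) (length b)) (0\<^sub>m (length b) (length a))
     (diag_of_list b) = diag_of_list (a @ b)"
  by (rule eq_matI) (auto simp: diag_of_list_def mat_diag_def nth_append)

lemma diag_block_mat_diag_of_list: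
  fixes c :: "'b \<Rightarrow> 'a :: zero list"
  shows "diag_block_mat (map (\<lambda>x. diag_of_list (c x)) xs) = diag_of_list (concat (map c xs))"
proof (induction xs)
  case Nil
  show ?case by (rule eq_matI) (auto simp: diag_of_list_def mat_diag_def)
next
  case (Cons x xs)
  have d: "dim_row (diag_of_list ds) = length ds" "dim_col (diag_of_list ds) = length ds"
    for ds :: "'a list"
    using diag_of_list_carrier[of ds] by blast+
  show ?case
    by (simp only: list.map concat.simps diag_block_mat.simps Let_def Cons.IH d diag_of_list_append)
qed

section \<open>Transporting skew-adjointness between matrices with a common eigenbasis\<close>

lemma zip_concat_map:
  assumes "\<And>x. x \<in> set xs \<Longrightarrow> length (c x) = length (a x)"
  shows "zip (concat (map c xs)) (concat (map a xs)) = concat (map (\<lambda>x. zip (c x) (a x)) xs)"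
  using assms by (induction xs) auto

text \<open>
  The pairs of corresponding entries form the graph of a partial function, since \<open>L\<close> is distinct;
  closure of the graph under negation makes this function odd.
\<close>

lemma opposite_entries_transfer:
  fixes L L' :: "'a :: group_add list"
  assumes dist: "distinct L" and len: "length L = length L'"
    and closed: "\<And>d e. (d, e) \<in> set (zip L L') \<Longrightarrow> (- d, - e) \<in> set (zip L L')"
    and uv: "u < length L" "v < length L" and sum: "L ! u + L ! v = 0"
  shows "L' ! u + L' ! v = 0"
proof -
  have "(L ! v, L' ! v) \<in> set (zip L L')" using uv len by (auto simp: set_zip)
  from closed[OF this] obtain w where w: "w < length L" "L ! w = - L ! v" "L' ! w = - L' ! v"
    by (auto simp: set_zip)
  have "L ! u = L ! w" using sum unfolding w(2) eq_neg_iff_add_eq_0 .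
  with dist uv(1) w(1) have "u = w" by (simp add: nth_eq_iff_index_eq)
  with w(3) show ?thesis by simp
qed

text \<open>
  The \<open>(i, j)\<close> entry of \<open>D H + H D\<close> is \<open>(d\<^sub>i + d\<^sub>j) H\<^sub>i\<^sub>j\<close>, so the hypothesis confines the support of \<open>H\<close> to
  positions at which \<open>e\<^sub>i + e\<^sub>j\<close> vanishes as well.
\<close>

lemma diag_skew_adjoint_transfer:
  fixes H :: "complex mat"
  assumes H: "H \<in> carrier_mat q q"
    and d: "mat_diag q d * H + H * mat_diag q d = 0\<^sub>m q q"
    and de: "\<And>u v. u < q \<Longrightarrow> v < q \<Longrightarrow> d u + d v = 0 \<Longrightarrow> e u + e v = 0"
  shows "mat_diag q e * H + H * mat_diag q e = 0\<^sub>m q q"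
proof (rule eq_matI)
  have entry: "(mat_diag q f * H + H * mat_diag q f) $$ (i,j) = (f i + f j) * H $$ (i,j)"
    if "i < q" "j < q" for i j f
    using that H by (simp add: mat_diag_mult_left[OF H] mat_diag_mult_right[OF H] algebra_simps)
  fix i j assume ij: "i < dim_row (0\<^sub>m q q :: complex mat)" "j < dim_col (0\<^sub>m q q :: complex mat)"
  hence "(d i + d j) * H $$ (i,j) = 0" using entry[of i j d] d by simp
  hence "(e i + e j) * H $$ (i,j) = 0" using de[of i j] ij by auto
  thus "(mat_diag q e * H + H * mat_diag q e) $$ (i,j) = 0\<^sub>m q q $$ (i,j)"
    using entry[of i j e] ij by simp
qed (use H in \<open>auto simp: mat_diag_def\<close>)

lemma skew_adjoint_congruence:
  fixes \<Lambda> G P D :: "complex mat"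
  assumes c: "\<Lambda> \<in> carrier_mat q q" "G \<in> carrier_mat q q" "P \<in> carrier_mat q q"
    and D: "D \<in> carrier_mat q q" "transpose_mat D = D" and PD: "\<Lambda> * P = P * D"
  shows "transpose_mat P * (transpose_mat \<Lambda> * G + G * \<Lambda>) * P
       = D * (transpose_mat P * G * P) + (transpose_mat P * G * P) * D"
proof -
  have dim: "dim_row \<Lambda> = q" "dim_col \<Lambda> = q" "dim_row G = q" "dim_col G = q" "dim_row P = q"
    "dim_col P = q" "dim_row D = q" "dim_col D = q" using c D by auto
  have "transpose_mat P * transpose_mat \<Lambda> = transpose_mat (\<Lambda> * P)"
    using dim by (simp add: transpose_mult_dim)
  also have "\<dots> = D * transpose_mat P" unfolding PD using dim D by (simp add: transpose_mult_dim)
  finally have PT: "transpose_mat P * transpose_mat \<Lambda> = D * transpose_mat P" .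
  have "transpose_mat P * (transpose_mat \<Lambda> * G + G * \<Lambda>) * P
      = transpose_mat P * (transpose_mat \<Lambda> * G) * P + transpose_mat P * (G * \<Lambda>) * P"
    using c by (subst mult_add_distrib_mat[of _ q q _ q], auto)
      (subst add_mult_distrib_mat[of _ q q _ _ q], auto)
  also have "transpose_mat P * (transpose_mat \<Lambda> * G) * P
      = (transpose_mat P * transpose_mat \<Lambda>) * G * P" using dim by (simp add: mult_mat_assoc)
  also have "\<dots> = D * (transpose_mat P * G * P)" unfolding PT using dim by (simp add: mult_mat_assoc)
  also have "transpose_mat P * (G * \<Lambda>) * P = transpose_mat P * G * (\<Lambda> * P)"
    using dim by (simp add: mult_mat_assoc)
  also have "\<dots> = (transpose_mat P * G * P) * D" unfolding PD using dim by (simp add: mult_mat_assoc)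
  finally show ?thesis .
qed

text \<open>
  The congruence by the common eigenvector matrix \<open>P\<close> replaces \<open>\<Lambda>\<close> and \<open>\<Lambda>'\<close> by diagonal matrices and
  \<open>G\<close> by \<open>P\<^sup>T G P\<close>; being invertible, it can be undone.
\<close>

lemma skew_adjoint_transfer:
  fixes \<Lambda> \<Lambda>' G P Q :: "complex mat"
  assumes c: "\<Lambda> \<in> carrier_mat q q" "\<Lambda>' \<in> carrier_mat q q" "G \<in> carrier_mat q q"
      "P \<in> carrier_mat q q" "Q \<in> carrier_mat q q"
    and PQ: "P * Q = 1\<^sub>m q"
    and diag: "\<Lambda> * P = P * mat_diag q d" "\<Lambda>' * P = P * mat_diag q e"
    and de: "\<And>u v. u < q \<Longrightarrow> v < q \<Longrightarrow> d u + d v = 0 \<Longrightarrow> e u + e v = 0"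
    and skew: "transpose_mat \<Lambda> * G + G * \<Lambda> = 0\<^sub>m q q"
  shows "transpose_mat \<Lambda>' * G + G * \<Lambda>' = 0\<^sub>m q q"
proof -
  let ?H = "transpose_mat P * G * P"
  let ?E = "transpose_mat \<Lambda>' * G + G * \<Lambda>'"
  have H: "?H \<in> carrier_mat q q" and E: "?E \<in> carrier_mat q q" using c by auto
  have T: "transpose_mat (mat_diag q f) = mat_diag q f" for f :: "nat \<Rightarrow> complex"
    by (rule eq_matI) (auto simp: mat_diag_def)
  have "mat_diag q d * ?H + ?H * mat_diag q d = transpose_mat P * 0\<^sub>m q q * P"
    using skew_adjoint_congruence[OF c(1,3,4) mat_diag_dim T diag(1)] skew by simp
  also have "\<dots> = 0\<^sub>m q q" using c by simp
  finally have "mat_diag q e * ?H + ?H * mat_diag q e = 0\<^sub>m q q"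
    by (rule diag_skew_adjoint_transfer[OF H _ de])
  with skew_adjoint_congruence[OF c(2,3,4) mat_diag_dim T diag(2)]
  have 0: "transpose_mat P * ?E * P = 0\<^sub>m q q" by simp
  have QP: "transpose_mat Q * transpose_mat P = 1\<^sub>m q"
    using c PQ by (metis transpose_mult transpose_one)
  have "?E = (transpose_mat Q * transpose_mat P) * ?E * (P * Q)" unfolding QP PQ left_mult_one_mat[OF E] right_mult_one_mat[OF E] ..
  also have "\<dots> = transpose_mat Q * (transpose_mat P * ?E * P) * Q"
    using c E by (simp add: mult_mat_assoc)
  also have "\<dots> = 0\<^sub>m q q" unfolding 0 using c by simp
  finally show ?thesis .
qed

section \<open>Structured updates of a deflating pair\<close>

lemma J_mat_carrier[simp]: "J_mat n \<in> carrier_mat (2*n) (2*n)"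
  unfolding J_mat_def by (rule carrier_matI) auto

lemma J_mat_orthogonal:
  "transpose_mat (J_mat n) * J_mat n = 1\<^sub>m (2*n)" "J_mat n * transpose_mat (J_mat n) = 1\<^sub>m (2*n)"
proof -
  have mz: "- 0\<^sub>m n n = (0\<^sub>m n n :: complex mat)" by (rule eq_matI) auto
  have one: "four_block_mat (1\<^sub>m n) (0\<^sub>m n n) (0\<^sub>m n n) (1\<^sub>m n) = (1\<^sub>m (2*n) :: complex mat)"
    by (rule eq_matI) auto
  have uu: "(- 1\<^sub>m n) * (- 1\<^sub>m n) = (1\<^sub>m n :: complex mat)" by (rule eq_matI) auto
  have T: "transpose_mat (J_mat n) = four_block_mat (0\<^sub>m n n) (- 1\<^sub>m n) (1\<^sub>m n) (0\<^sub>m n n)"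
    unfolding J_mat_def by (subst transpose_four_block_mat[of _ n n _ n _ n]) (auto simp: transpose_uminus)
  show "transpose_mat (J_mat n) * J_mat n = 1\<^sub>m (2*n)"
    unfolding T unfolding J_mat_def by (subst mult_four_block_mat[of _ n n _ n _ n]) (auto simp: uu one mz)
  show "J_mat n * transpose_mat (J_mat n) = 1\<^sub>m (2*n)"
    unfolding T unfolding J_mat_def by (subst mult_four_block_mat[of _ n n _ n _ n]) (auto simp: uu one mz)
qed

lemma transpose_congruence:
  fixes A U :: "'a :: comm_semiring_0 mat"
  assumes "U \<in> carrier_mat N q" and "A \<in> carrier_mat q q"
  shows "transpose_mat (U * A * transpose_mat U) = U * transpose_mat A * transpose_mat U"
  using assms by (simp add: transpose_mult_dim mult_mat_assoc)

text \<open>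
  One deflating pair of a T-skew-Hamiltonian/Hamiltonian pencil for which the form induced by \<open>J M\<close>
  on the column space of \<open>X\<close> is nondegenerate.
\<close>

locale structured_deflating_pair =
  fixes n q :: nat and M K X \<Lambda> :: "complex mat"
  assumes M: "T_skew_Hamiltonian n M" and K: "T_Hamiltonian n K"
    and X[simp]: "X \<in> carrier_mat (2*n) q" and \<Lambda>[simp]: "\<Lambda> \<in> carrier_mat q q"
    and deflating: "M * X * \<Lambda> + K * X = 0\<^sub>m (2*n) q"
    and G_invertible: "invertible_mat (G_mat n M X)"
begin

declare mult_carrier_mat_iff[simp]

abbreviation J where "J \<equiv> J_mat n"
abbreviation G where "G \<equiv> G_mat n M X"
abbreviation U where "U \<equiv> U_mat n M X"

lemma M_carrier[simp]: "M \<in> carrier_mat (2*n) (2*n)" and K_carrier[simp]: "K \<in> carrier_mat (2*n) (2*n)"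
  using M K unfolding T_skew_Hamiltonian_def T_Hamiltonian_def by auto

lemma JM_skew: "transpose_mat (J * M) = - (J * M)" and JK_symmetric: "transpose_mat (J * K) = J * K"
  using M K unfolding T_skew_Hamiltonian_def T_Hamiltonian_def by auto

lemma G_carrier[simp]: "G \<in> carrier_mat q q"
  unfolding G_mat_def by (rule carrier_matI) (use carrier_matD[OF X] in auto)

lemmas G_inverse = mat_inverse_invertible[OF G_carrier G_invertible]

lemma U_carrier[simp]: "U \<in> carrier_mat (2*n) q"
  unfolding U_mat_def by (rule carrier_matI) (use carrier_matD[OF G_inverse(1)] carrier_matD[OF J_mat_carrier[of n]] in auto)

lemma dims[simp]:
  "dim_row X = 2*n" "dim_col X = q" "dim_row \<Lambda> = q" "dim_col \<Lambda> = q"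
  "dim_row M = 2*n" "dim_col M = 2*n" "dim_row K = 2*n" "dim_col K = 2*n"
  "dim_row J = 2*n" "dim_col J = 2*n" "dim_row G = q" "dim_col G = q" "dim_row U = 2*n" "dim_col U = q"
  using X \<Lambda> M_carrier K_carrier J_mat_carrier[of n] G_carrier U_carrier by blast+

lemma K_X: "K * X = - (M * X * \<Lambda>)"
proof (rule eq_matI)
  fix i j assume "i < dim_row (- (M * X * \<Lambda>))" "j < dim_col (- (M * X * \<Lambda>))"
  moreover from this have "(M * X * \<Lambda> + K * X) $$ (i,j) = 0" unfolding deflating by auto
  ultimately show "(K * X) $$ (i,j) = (- (M * X * \<Lambda>)) $$ (i,j)"
    by (simp add: add_eq_0_iff)
qed auto

lemma G_skew: "transpose_mat G = - G"
proof -
  have "transpose_mat G = transpose_mat X * transpose_mat (J * M) * X"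
    unfolding G_mat_def by (simp add: transpose_mult_dim mult_mat_assoc)
  also have "\<dots> = - G" unfolding JM_skew G_mat_def by (simp add: mult_mat_assoc)
  finally show ?thesis .
qed

text \<open>
  The deflation equation gives \<open>G \<Lambda> = - X\<^sup>T (J K) X\<close>, and \<open>J K\<close> is symmetric.
\<close>

lemma G_\<Lambda>_symmetric: "transpose_mat (G * \<Lambda>) = G * \<Lambda>"
proof -
  have "G * \<Lambda> = transpose_mat X * J * (M * X * \<Lambda>)" unfolding G_mat_def by (simp add: mult_mat_assoc)
  also have "M * X * \<Lambda> = - (K * X)" unfolding K_X by (rule eq_matI) auto
  finally have GL: "G * \<Lambda> = - (transpose_mat X * (J * K) * X)" by (simp add: mult_mat_assoc)
  have "transpose_mat (transpose_mat X * (J * K) * X) = transpose_mat X * transpose_mat (J * K) * X"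
    by (simp add: transpose_mult_dim mult_mat_assoc)
  thus ?thesis unfolding GL transpose_uminus JK_symmetric by simp
qed

lemma skew_adjoint_iff_symmetric:
  assumes A: "A \<in> carrier_mat q q"
  shows "transpose_mat A * G + G * A = 0\<^sub>m q q \<longleftrightarrow> transpose_mat (G * A) = G * A"
proof -
  have d: "dim_row A = q" "dim_col A = q" using A by auto
  have T: "transpose_mat (G * A) = - (transpose_mat A * G)"
    using d by (simp add: transpose_mult_dim G_skew)
  have "B + C = 0\<^sub>m q q \<longleftrightarrow> - B = C" if "B \<in> carrier_mat q q" "C \<in> carrier_mat q q"
    for B C :: "complex mat"
    using that by (auto simp: mat_eq_iff add_eq_0_iff minus_equation_iff)
  from this[of "transpose_mat A * G" "G * A"] show ?thesis unfolding T using d by simp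
qed

lemma U_transpose: "transpose_mat U = transpose_mat (the (mat_inverse G)) * transpose_mat (J * M * X)"
  unfolding U_mat_def using G_inverse(1) by (simp add: transpose_mult_dim)

lemma JMX_transpose: "transpose_mat (J * M * X) = - (transpose_mat X * (J * M))"
proof -
  have "transpose_mat (J * M * X) = transpose_mat X * transpose_mat (J * M)"
    by (simp add: transpose_mult_dim)
  thus ?thesis unfolding JM_skew by simp
qed

lemma U_X: "transpose_mat U * X = 1\<^sub>m q"
proof -
  have "transpose_mat (J * M * X) * X = transpose_mat G"
    unfolding JMX_transpose G_skew by (simp add: G_mat_def mult_mat_assoc)
  hence "transpose_mat U * X = transpose_mat (G * the (mat_inverse G))"
    unfolding U_transpose using G_inverse(1) by (simp add: mult_mat_assoc transpose_mult_dim[of G])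
  thus ?thesis unfolding G_inverse(2) by simp
qed

text \<open>
  This is what lets the updates cancel the action of \<open>M\<close> on \<open>X\<close>.
\<close>

lemma JU_G: "transpose_mat J * U * G = M * X"
proof -
  have "transpose_mat J * U * G
      = (transpose_mat J * J) * (M * X) * (the (mat_inverse G) * G)"
    unfolding U_mat_def using G_inverse(1) by (simp add: mult_mat_assoc)
  thus ?thesis unfolding J_mat_orthogonal G_inverse(3) by simp
qed

text \<open>
  For \<open>Z = (J M X)\<^sup>T Y\<close>, transposing the deflation equation of \<open>X\<close> and using that of \<open>Y\<close> evaluates
  \<open>X\<^sup>T (J K) Y\<close> in two ways, which yields \<open>\<Lambda>\<^sup>T Z = - Z \<Theta>\<close>. Its transpose is a homogeneous Sylvester equation
  with coefficients \<open>- \<Theta>\<^sup>T\<close> and \<open>\<Lambda>\<close>, which by hypothesis have no eigenvalue in common.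
\<close>

lemma U_complement:
  assumes Y[simp]: "Y \<in> carrier_mat (2*n) r" and \<Theta>[simp]: "\<Theta> \<in> carrier_mat r r"
    and Y_defl: "M * Y * \<Theta> + K * Y = 0\<^sub>m (2*n) r"
    and disj: "spectrum \<Lambda> \<inter> spectrum (- transpose_mat \<Theta>) = {}"
  shows "transpose_mat U * Y = 0\<^sub>m q r"
proof -
  have d[simp]: "dim_row Y = 2*n" "dim_col Y = r" "dim_row \<Theta> = r" "dim_col \<Theta> = r" using Y \<Theta> by blast+
  define Z where "Z = transpose_mat (J * M * X) * Y"
  have Z[simp]: "Z \<in> carrier_mat q r" unfolding Z_def by (rule carrier_matI) auto
  have KY: "K * Y = - (M * Y * \<Theta>)"
  proof (rule eq_matI)
    fix i j assume "i < dim_row (- (M * Y * \<Theta>))" "j < dim_col (- (M * Y * \<Theta>))"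
    moreover from this have "(M * Y * \<Theta> + K * Y) $$ (i,j) = 0" unfolding Y_defl by auto
    ultimately show "(K * Y) $$ (i,j) = (- (M * Y * \<Theta>)) $$ (i,j)"
      by (simp add: add_eq_0_iff)
  qed auto
  have "transpose_mat \<Lambda> * Z = transpose_mat (J * (M * X * \<Lambda>)) * Y"
    unfolding Z_def by (simp add: transpose_mult_dim mult_mat_assoc)
  also have "M * X * \<Lambda> = - (K * X)" unfolding K_X by (rule eq_matI) auto
  also have "J * (- (K * X)) = - (J * K * X)" by (simp add: mult_mat_assoc)
  also have "transpose_mat (- (J * K * X)) = - (transpose_mat X * (J * K))"
    using JK_symmetric by (simp add: transpose_uminus transpose_mult_dim[of "J * K" X])
  also have "- (transpose_mat X * (J * K)) * Y = - (transpose_mat X * J * (K * Y))"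
    by (simp add: mult_mat_assoc)
  also have "\<dots> = transpose_mat X * J * (M * Y * \<Theta>)"
    unfolding KY by (rule eq_matI) auto
  also have "\<dots> = - (Z * \<Theta>)"
    unfolding Z_def JMX_transpose by (simp add: mult_mat_assoc)
  finally have "transpose_mat \<Lambda> * Z = - (Z * \<Theta>)" .
  hence "transpose_mat (transpose_mat \<Lambda> * Z) = transpose_mat (- (Z * \<Theta>))" by simp
  hence syl: "(- transpose_mat \<Theta>) * transpose_mat Z = transpose_mat Z * \<Lambda>"
    using carrier_matD[OF Z] by (simp add: transpose_uminus transpose_mult_dim)
  have "transpose_mat Z = 0\<^sub>m r q"
    by (rule sylvester_homogeneous_trivial[OF _ _ _ syl]) (use disj in auto)
  hence "Z = 0\<^sub>m q r" by (metis transpose_transpose zero_transpose_mat)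
  moreover have "transpose_mat U * Y = transpose_mat (the (mat_inverse G)) * Z"
    unfolding U_transpose Z_def using G_inverse(1) by (simp add: mult_mat_assoc)
  ultimately show ?thesis using G_inverse(1) by simp
qed

context
  fixes Mh \<Lambda>' :: "complex mat"
  assumes Mh[simp]: "Mh \<in> carrier_mat q q" and \<Lambda>'[simp]: "\<Lambda>' \<in> carrier_mat q q"
begin

lemma update_carriers[simp]:
  "dim_row Mh = q" "dim_col Mh = q" "dim_row \<Lambda>' = q" "dim_col \<Lambda>' = q"
  "Delta_M n M X Mh \<in> carrier_mat (2*n) (2*n)" "Delta_K n M X \<Lambda> \<Lambda>' Mh \<in> carrier_mat (2*n) (2*n)"
  using carrier_matD[OF Mh] carrier_matD[OF \<Lambda>'] unfolding Delta_M_def Delta_K_def by simp_all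

text \<open>
  With \<open>W = J\<^sup>T U\<close> one has \<open>W G = M X\<close> and \<open>U\<^sup>T X = I\<close>, so \<open>\<Delta>K X = M X \<Lambda> - M X \<Lambda>' - W Mh \<Lambda>'\<close>. The last two terms
  cancel \<open>(M + \<Delta>M) X \<Lambda>'\<close>, and the first cancels \<open>K X\<close>.
\<close>

lemma updated_pair_deflates:
  "(M + Delta_M n M X Mh) * X * \<Lambda>' + (K + Delta_K n M X \<Lambda> \<Lambda>' Mh) * X = 0\<^sub>m (2*n) q"
proof -
  define W where "W = transpose_mat J * U"
  have W[simp]: "W \<in> carrier_mat (2*n) q" "dim_row W = 2*n" "dim_col W = q" unfolding W_def by auto
  have WG: "W * G = M * X" unfolding W_def by (rule JU_G)
  have DM: "Delta_M n M X Mh * X = W * Mh"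
    unfolding Delta_M_def W_def by (simp add: mult_mat_assoc U_X)
  have "Delta_K n M X \<Lambda> \<Lambda>' Mh * X = W * (G * \<Lambda> - (G + Mh) * \<Lambda>')"
    unfolding Delta_K_def W_def by (simp add: mult_mat_assoc U_X)
  also have "\<dots> = W * G * \<Lambda> - (W * G * \<Lambda>' + W * Mh * \<Lambda>')"
    by (simp add: mult_minus_distrib_mat[of _ "2*n" q _ q] add_mult_distrib_mat[of _ q q _ _ q]
        mult_add_distrib_mat[of _ "2*n" q _ q] mult_mat_assoc)
  finally have DK: "Delta_K n M X \<Lambda> \<Lambda>' Mh * X = M * X * \<Lambda> - (M * X * \<Lambda>' + W * Mh * \<Lambda>')"
    unfolding WG .
  have "(M + Delta_M n M X Mh) * X * \<Lambda>' = M * X * \<Lambda>' + W * Mh * \<Lambda>'"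
    by (simp add: add_mult_distrib_mat[of _ "2*n" "2*n" _ _ q] add_mult_distrib_mat[of _ "2*n" q _ _ q] DM)
  moreover have "(K + Delta_K n M X \<Lambda> \<Lambda>' Mh) * X
      = - (M * X * \<Lambda>) + (M * X * \<Lambda> - (M * X * \<Lambda>' + W * Mh * \<Lambda>'))"
    by (simp add: add_mult_distrib_mat[of _ "2*n" "2*n" _ _ q] DK K_X)
  ultimately show ?thesis by (auto intro!: eq_matI)
qed

lemma updated_pencil_agrees_on_complement:
  assumes Y[simp]: "Y \<in> carrier_mat (2*n) r" and UY: "transpose_mat U * Y = 0\<^sub>m q r"
  shows "(M + Delta_M n M X Mh) * Y = M * Y" "(K + Delta_K n M X \<Lambda> \<Lambda>' Mh) * Y = K * Y"
proof -
  have [simp]: "dim_row Y = 2*n" "dim_col Y = r" using Y by blast+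
  have "Delta_M n M X Mh * Y = 0\<^sub>m (2*n) r" "Delta_K n M X \<Lambda> \<Lambda>' Mh * Y = 0\<^sub>m (2*n) r"
    unfolding Delta_M_def Delta_K_def by (simp_all add: mult_mat_assoc UY)
  thus "(M + Delta_M n M X Mh) * Y = M * Y" "(K + Delta_K n M X \<Lambda> \<Lambda>' Mh) * Y = K * Y"
    by (simp_all add: add_mult_distrib_mat[of _ "2*n" "2*n" _ _ r] right_add_zero_mat[of _ "2*n" r])
qed

lemma Delta_M_skew_Hamiltonian:
  assumes "transpose_mat Mh = - Mh"
  shows "T_skew_Hamiltonian n (Delta_M n M X Mh)"
proof -
  have JD: "J * Delta_M n M X Mh = U * Mh * transpose_mat U"
  proof -
    have "J * Delta_M n M X Mh = (J * transpose_mat J) * (U * Mh * transpose_mat U)"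
      unfolding Delta_M_def by (simp add: mult_mat_assoc)
    thus ?thesis unfolding J_mat_orthogonal by simp
  qed
  show ?thesis unfolding T_skew_Hamiltonian_def JD
    by (simp add: transpose_congruence[OF U_carrier Mh] assms)
qed

lemma Delta_K_Hamiltonian:
  assumes G\<Lambda>': "transpose_mat (G * \<Lambda>') = G * \<Lambda>'" and Mh\<Lambda>': "transpose_mat (Mh * \<Lambda>') = Mh * \<Lambda>'"
  shows "T_Hamiltonian n (Delta_K n M X \<Lambda> \<Lambda>' Mh)"
proof -
  let ?A = "G * \<Lambda> - (G + Mh) * \<Lambda>'"
  have A: "?A \<in> carrier_mat q q" by auto
  have "?A = G * \<Lambda> - (G * \<Lambda>' + Mh * \<Lambda>')" by (simp add: add_mult_distrib_mat[of _ q q _ _ q])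
  hence sym: "transpose_mat ?A = ?A"
    by (simp add: transpose_minus[of _ q q] transpose_add[of _ q q] G_\<Lambda>_symmetric G\<Lambda>' Mh\<Lambda>')
  have JD: "J * Delta_K n M X \<Lambda> \<Lambda>' Mh = U * ?A * transpose_mat U"
  proof -
    have "J * Delta_K n M X \<Lambda> \<Lambda>' Mh = (J * transpose_mat J) * (U * ?A * transpose_mat U)"
      unfolding Delta_K_def by (simp add: mult_mat_assoc)
    thus ?thesis unfolding J_mat_orthogonal by simp
  qed
  show ?thesis unfolding T_Hamiltonian_def JD
    by (simp add: transpose_congruence[OF U_carrier A] sym)
qed

end

end

section \<open>The blocks of the eigenvalue, eigenvector and update matrices\<close>

definition mat2 :: "'a \<Rightarrow> 'a \<Rightarrow> 'a \<Rightarrow> 'a \<Rightarrow> 'a mat" where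
  "mat2 a b c d = mat_of_rows_list 2 [[a, b], [c, d]]"

lemma mat2_carrier[simp]: "mat2 a b c d \<in> carrier_mat 2 2"
  unfolding mat2_def mat_of_rows_list_def by (rule carrier_matI) simp_all

lemma mat2_dim[simp]: "dim_row (mat2 a b c d) = 2" "dim_col (mat2 a b c d) = 2"
  unfolding mat2_def mat_of_rows_list_def by simp_all

lemma mat2_index[simp]:
  "mat2 a b c d $$ (0,0) = a" "mat2 a b c d $$ (0,1) = b" "mat2 a b c d $$ (0,Suc 0) = b"
  "mat2 a b c d $$ (1,0) = c" "mat2 a b c d $$ (1,1) = d"
  "mat2 a b c d $$ (Suc 0,0) = c" "mat2 a b c d $$ (Suc 0,Suc 0) = d"
  unfolding mat2_def mat_of_rows_list_def by simp_all

lemma eq_mat2I: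
  assumes "dim_row A = 2" "dim_col A = 2"
    and "A $$ (0,0) = a" "A $$ (0,1) = b" "A $$ (1,0) = c" "A $$ (1,1) = d"
  shows "A = mat2 a b c d"
  by (rule eq_matI) (use assms in \<open>auto simp: less_2_cases_iff\<close>)

lemma mat2_mult:
  fixes a :: "'a :: semiring_0"
  shows "mat2 a b c d * mat2 a' b' c' d' =
     mat2 (a*a' + b*c') (a*b' + b*d') (c*a' + d*c') (c*b' + d*d')"
  by (rule eq_mat2I) (simp_all add: scalar_prod_def numeral_2_eq_2)

lemma mat2_transpose: "transpose_mat (mat2 a b c d) = mat2 a c b d"
  by (rule eq_mat2I) simp_all

lemma mat2_uminus:
  fixes a :: "'a :: group_add"
  shows "- mat2 a b c d = mat2 (- a) (- b) (- c) (- d)"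
  by (rule eq_mat2I) simp_all

lemma mat2_add: "mat2 a b c d + mat2 a' b' c' d' = mat2 (a + a') (b + b') (c + c') (d + d')"
  by (rule eq_mat2I) simp_all

lemma mat2_smult: "e \<cdot>\<^sub>m mat2 a b c d = mat2 (e * a) (e * b) (e * c) (e * d)"
  by (rule eq_mat2I) simp_all

lemma mat2_one: "1\<^sub>m 2 = mat2 1 0 0 1"
  by (rule eq_mat2I) simp_all

lemma mat2_diag_of_list: "diag_of_list [a, b] = mat2 a 0 0 b"
  by (rule eq_mat2I) (simp_all add: diag_of_list_def mat_diag_def)

lemma mat2_J_mat: "J_mat (Suc 0) = mat2 0 1 (- 1) 0"
  unfolding J_mat_def by (rule eq_mat2I) simp_all

lemma mat2_map: "map_mat f (mat_of_rows_list 2 [[a, b], [c, d]]) = mat2 (f a) (f b) (f c) (f d)"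
  unfolding mat2_def[symmetric] by (rule eq_mat2I) simp_all

lemma Lambda_hat_mat2: "Lambda_hat z = mat2 (Re z) (Im z) (- Im z) (Re z)"
  unfolding Lambda_hat_def mat2_map by simp

lemmas mat2_simps = mat2_mult mat2_transpose mat2_uminus mat2_add mat2_smult mat2_one
  mat2_diag_of_list mat2_J_mat Lambda_hat_mat2

text \<open>
  Hence the second half of a quadruple block is again of the form \<open>Lambda_hat\<close>, and the whole block
  can be diagonalised by two copies of the same \<open>2 \<times> 2\<close> matrix.
\<close>

lemma neg_transpose_Lambda_hat: "- transpose_mat (Lambda_hat z) = Lambda_hat (- cnj z)"
  by (simp add: mat2_simps)

text \<open>
  Its columns \<open>(1, \<i>)\<close> and \<open>(1, - \<i>)\<close> are eigenvectors of every \<open>Lambda_hat z\<close>: this independence of \<open>z\<close> is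
  what gives the current and the aimed eigenvalue matrix a common eigenbasis.
\<close>

definition eigvecs2 :: "complex mat" where
  "eigvecs2 = mat2 1 1 \<i> (- \<i>)"

lemma Lambda_hat_eigvecs2: "Lambda_hat z * eigvecs2 = eigvecs2 * diag_of_list [z, cnj z]"
  by (simp add: eigvecs2_def mat2_simps)
    (rule eq_mat2I; simp add: complex_eq_iff)

definition eigvecs2_inv :: "complex mat" where
  "eigvecs2_inv = mat2 (1/2) (- \<i>/2) (1/2) (\<i>/2)"

lemma eigvecs2_inverse: "eigvecs2 * eigvecs2_inv = 1\<^sub>m 2"
  by (simp add: eigvecs2_def eigvecs2_inv_def mat2_simps)

text \<open>
  Reading the three index ranges as one list with a case distinction at each index lets every
  block-diagonal matrix of the theorem be treated as \<open>diag_block_mat (map F [1..<p+1])\<close>, so that products,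
  transposes and diagonalisations can be computed one index at a time. The first range is tested by
  \<open>i \<le> m1\<close> alone, so index \<open>0\<close>, which is outside the list, counts as a quadruple.
\<close>

definition pick_range :: "nat \<Rightarrow> nat \<Rightarrow> (nat \<Rightarrow> 'b) \<Rightarrow> (nat \<Rightarrow> 'b) \<Rightarrow> (nat \<Rightarrow> 'b) \<Rightarrow> nat \<Rightarrow> 'b" where
  "pick_range m1 m2 f g h i = (if i \<le> m1 then f i else if i \<le> m2 then g i else h i)"

lemma three_ranges_pick:
  assumes "m1 \<le> m2" and "m2 \<le> p"
  shows "three_ranges m1 m2 p f g h = map (pick_range m1 m2 f g h) [1..<p+1]"
proof -
  have "[1..<p+1] = [1..<m1+1] @ [m1+1..<p+1]"
    using upt_add_eq_append[of 1 "m1+1" "p - m1"] assms by simp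
  also have "[m1+1..<p+1] = [m1+1..<m2+1] @ [m2+1..<p+1]"
    using upt_add_eq_append[of "m1+1" "m2+1" "p - m2"] assms by simp
  finally have "[1..<p+1] = [1..<m1+1] @ [m1+1..<m2+1] @ [m2+1..<p+1]" .
  thus ?thesis unfolding three_ranges_def using assms
    by (auto simp: pick_range_def simp del: upt_Suc)
qed

definition block_size :: "nat \<Rightarrow> nat \<Rightarrow> nat" where
  "block_size m1 i = (if i \<le> m1 then 4 else 2)"

lemma sum_block_size:
  assumes "m1 \<le> p"
  shows "sum_list (map (block_size m1) [1..<p+1]) = 2 * m1 + 2 * p"
proof -
  have "[1..<p+1] = [1..<m1+1] @ [m1+1..<p+1]"
    using upt_add_eq_append[of 1 "m1+1" "p - m1"] assms by simp
  hence "sum_list (map (block_size m1) [1..<p+1])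
      = sum_list (map (\<lambda>_. 4) [1..<m1+1]) + sum_list (map (\<lambda>_. 2) [m1+1..<p+1])"
    by (auto simp: block_size_def simp del: upt_Suc intro!: arg_cong2[where f="(+)"]
        arg_cong[where f=sum_list])
  thus ?thesis using assms by (simp add: sum_list_triv del: upt_Suc)
qed

definition eigval_block :: "nat \<Rightarrow> nat \<Rightarrow> (nat \<Rightarrow> complex) \<Rightarrow> nat \<Rightarrow> complex list" where
  "eigval_block m1 m2 \<mu> = pick_range m1 m2
     (\<lambda>j. [\<mu> j, cnj (\<mu> j), - cnj (\<mu> j), - \<mu> j]) (\<lambda>k. [\<mu> k, cnj (\<mu> k)]) (\<lambda>l. [\<mu> l, - \<mu> l])"

definition Lambda_block :: "nat \<Rightarrow> nat \<Rightarrow> (nat \<Rightarrow> complex) \<Rightarrow> nat \<Rightarrow> complex mat" where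
  "Lambda_block m1 m2 \<mu> = pick_range m1 m2
     (\<lambda>j. diag_block_mat [Lambda_hat (\<mu> j), - transpose_mat (Lambda_hat (\<mu> j))])
     (\<lambda>k. map_mat complex_of_real (mat_of_rows_list 2 [[0, Im (\<mu> k)], [- Im (\<mu> k), 0]]))
     (\<lambda>l. mat_of_rows_list 2 [[\<mu> l, 0], [0, - \<mu> l]])"

definition M_hat_block :: "nat \<Rightarrow> nat \<Rightarrow> (nat \<Rightarrow> real) \<Rightarrow> (nat \<Rightarrow> real) \<Rightarrow> nat \<Rightarrow> complex mat" where
  "M_hat_block m1 m2 \<alpha> \<beta> = pick_range m1 m2
     (\<lambda>j. four_block_mat
        (0\<^sub>m 2 2)
        (complex_of_real (\<alpha> j) \<cdot>\<^sub>m 1\<^sub>m 2 + complex_of_real (\<beta> j) \<cdot>\<^sub>m J_mat 1)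
        (- complex_of_real (\<alpha> j) \<cdot>\<^sub>m 1\<^sub>m 2 + complex_of_real (\<beta> j) \<cdot>\<^sub>m J_mat 1)
        (0\<^sub>m 2 2))
     (\<lambda>k. complex_of_real (\<beta> k) \<cdot>\<^sub>m J_mat 1)
     (\<lambda>l. complex_of_real (\<beta> l) \<cdot>\<^sub>m J_mat 1)"

definition eigvec_block :: "nat \<Rightarrow> nat \<Rightarrow> nat \<Rightarrow> complex mat" where
  "eigvec_block m1 m2 = pick_range m1 m2
     (\<lambda>_. diag_block_mat [eigvecs2, eigvecs2]) (\<lambda>_. eigvecs2) (\<lambda>_. 1\<^sub>m 2)"

definition eigvec_inv_block :: "nat \<Rightarrow> nat \<Rightarrow> nat \<Rightarrow> complex mat" where
  "eigvec_inv_block m1 m2 = pick_range m1 m2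
     (\<lambda>_. diag_block_mat [eigvecs2_inv, eigvecs2_inv]) (\<lambda>_. eigvecs2_inv) (\<lambda>_. 1\<^sub>m 2)"

lemma eigvecs2_carrier[simp]: "eigvecs2 \<in> carrier_mat 2 2" "eigvecs2_inv \<in> carrier_mat 2 2"
  unfolding eigvecs2_def eigvecs2_inv_def by simp_all

lemma Lambda_hat_carrier[simp]: "Lambda_hat z \<in> carrier_mat 2 2"
  unfolding Lambda_hat_mat2 by simp

lemma diag_block2_mult:
  fixes A B C D :: "'a :: semiring_0 mat"
  assumes "A \<in> carrier_mat m m" "B \<in> carrier_mat k k" "C \<in> carrier_mat m m" "D \<in> carrier_mat k k"
  shows "diag_block_mat [A, B] * diag_block_mat [C, D] = diag_block_mat [A * C, B * D]"
  using diag_block_mat_mult[of "[True, False]" "\<lambda>b. if b then A else B" "\<lambda>b. if b then m else k"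
      "\<lambda>b. if b then C else D"] assms by (simp del: diag_block_mat.simps)

lemma diag_block2_four_block:
  "A \<in> carrier_mat m m \<Longrightarrow> B \<in> carrier_mat k k \<Longrightarrow>
     diag_block_mat [A, B] = four_block_mat A (0\<^sub>m m k) (0\<^sub>m k m) B"
  by (auto simp: Let_def intro!: eq_matI)

lemma diag_block2_carrier:
  assumes "A \<in> carrier_mat 2 2" "B \<in> carrier_mat 2 2"
  shows "diag_block_mat [A, B] \<in> carrier_mat 4 4"
  unfolding diag_block2_four_block[OF assms] using four_block_carrier_mat[OF assms] by simp

lemma block_carriers:
  "length (eigval_block m1 m2 \<mu> i) = block_size m1 i"
  "Lambda_block m1 m2 \<mu> i \<in> carrier_mat (block_size m1 i) (block_size m1 i)"
  "M_hat_block m1 m2 \<alpha> \<beta> i \<in> carrier_mat (block_size m1 i) (block_size m1 i)"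
  "eigvec_block m1 m2 i \<in> carrier_mat (block_size m1 i) (block_size m1 i)"
  "eigvec_inv_block m1 m2 i \<in> carrier_mat (block_size m1 i) (block_size m1 i)"
  using four_block_carrier_mat[of "0\<^sub>m 2 2 :: complex mat" 2 2 "0\<^sub>m 2 2" 2 2]
  by (simp_all add: eigval_block_def Lambda_block_def M_hat_block_def eigvec_block_def
      eigvec_inv_block_def block_size_def pick_range_def diag_block2_carrier
      neg_transpose_Lambda_hat mat2_map mat2_def[symmetric] mat2_J_mat mat2_smult
      del: diag_block_mat.simps)

lemma Lambda_block_eigvecs:
  assumes "m1 < i \<Longrightarrow> i \<le> m2 \<Longrightarrow> Re (\<mu> i) = 0"
  shows "Lambda_block m1 m2 \<mu> i * eigvec_block m1 m2 i
       = eigvec_block m1 m2 i * diag_of_list (eigval_block m1 m2 \<mu> i)"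
proof -
  let ?z = "\<mu> i"
  consider (quad) "i \<le> m1" | (imag) "m1 < i" "i \<le> m2" | (real) "m1 < i" "m2 < i" by linarith
  thus ?thesis
  proof cases
    case quad
    have "diag_of_list [?z, cnj ?z, - cnj ?z, - ?z]
        = diag_block_mat [diag_of_list [?z, cnj ?z], diag_of_list [- cnj ?z, - ?z]]"
      using diag_block_mat_diag_of_list[of "\<lambda>z. [z, cnj z]" "[?z, - cnj ?z]"]
      by (simp del: diag_block_mat.simps)
    with quad show ?thesis
      using Lambda_hat_eigvecs2[of ?z] Lambda_hat_eigvecs2[of "- cnj ?z"]
      by (simp add: Lambda_block_def eigvec_block_def eigval_block_def pick_range_def
          neg_transpose_Lambda_hat diag_block2_mult[of _ 2 _ 2] mat2_diag_of_list
          del: diag_block_mat.simps)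
  next
    case imag
    hence "map_mat complex_of_real (mat_of_rows_list 2 [[0, Im ?z], [- Im ?z, 0]]) = Lambda_hat ?z"
      using assms by (simp add: mat2_map Lambda_hat_mat2)
    with imag show ?thesis
      by (simp add: Lambda_block_def eigvec_block_def eigval_block_def pick_range_def
          Lambda_hat_eigvecs2)
  next
    case real
    thus ?thesis
      by (simp add: Lambda_block_def eigvec_block_def eigval_block_def pick_range_def
          mat2_def[symmetric] mat2_diag_of_list)
  qed
qed

lemma eigvec_block_inverse: "eigvec_block m1 m2 i * eigvec_inv_block m1 m2 i = 1\<^sub>m (block_size m1 i)"
proof -
  have "diag_block_mat [1\<^sub>m 2, 1\<^sub>m 2] = (1\<^sub>m 4 :: complex mat)"
    using diag_block_mat_one[of "\<lambda>_. 2" "[True, False]"] by (simp del: diag_block_mat.simps)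
  thus ?thesis
    by (simp add: eigvec_block_def eigvec_inv_block_def block_size_def pick_range_def
        diag_block2_mult[of _ 2 _ 2] eigvecs2_inverse del: diag_block_mat.simps)
qed

text \<open>
  All \<open>2 \<times> 2\<close> blocks involved, except the diagonal block of a real pair, are combinations of the
  identity and \<open>J_mat 1\<close> and hence commute. In a quadruple block \<open>Mh\<close> is off-diagonal with entries \<open>B\<close> and
  \<open>- B\<^sup>T\<close>, and \<open>\<Lambda>\<close> is diagonal with entries \<open>L\<close> and \<open>- L\<^sup>T\<close>; their product is off-diagonal with entries
  \<open>- B L\<^sup>T\<close> and \<open>- B\<^sup>T L\<close>, and these are transposes of each other because \<open>B\<^sup>T\<close> and \<open>L\<close> commute. For a real pair,
  \<open>J_mat 1\<close> times \<open>diag(z, - z)\<close> is symmetric.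
\<close>

lemma M_hat_block_symmetry:
  assumes "m1 < i \<Longrightarrow> i \<le> m2 \<Longrightarrow> Re (\<mu> i) = 0"
  shows "transpose_mat (M_hat_block m1 m2 \<alpha> \<beta> i) = - M_hat_block m1 m2 \<alpha> \<beta> i" (is ?skew)
    and "transpose_mat (M_hat_block m1 m2 \<alpha> \<beta> i * Lambda_block m1 m2 \<mu> i)
       = M_hat_block m1 m2 \<alpha> \<beta> i * Lambda_block m1 m2 \<mu> i" (is ?sym)
proof -
  let ?z = "\<mu> i" and ?a = "complex_of_real (\<alpha> i)" and ?b = "complex_of_real (\<beta> i)"
  consider (quad) "i \<le> m1" | (imag) "m1 < i" "i \<le> m2" | (real) "m1 < i" "m2 < i" by linarith
  hence "?skew \<and> ?sym"
  proof cases
    case quad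
    let ?B = "mat2 ?a ?b (- ?b) ?a" and ?C = "mat2 (- ?a) ?b (- ?b) (- ?a)"
    have z0: "- 0\<^sub>m 2 2 = (0\<^sub>m 2 2 :: complex mat)" by (rule eq_matI) auto
    have Mh: "M_hat_block m1 m2 \<alpha> \<beta> i = four_block_mat (0\<^sub>m 2 2) ?B ?C (0\<^sub>m 2 2)"
      using quad by (simp add: M_hat_block_def pick_range_def mat2_simps)
    have L: "Lambda_block m1 m2 \<mu> i
        = four_block_mat (Lambda_hat ?z) (0\<^sub>m 2 2) (0\<^sub>m 2 2) (Lambda_hat (- cnj ?z))"
      using quad by (simp add: Lambda_block_def pick_range_def neg_transpose_Lambda_hat
          diag_block2_four_block[of _ 2 _ 2] del: diag_block_mat.simps)
    have prod: "M_hat_block m1 m2 \<alpha> \<beta> i * Lambda_block m1 m2 \<mu> i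
        = four_block_mat (0\<^sub>m 2 2) (?B * Lambda_hat (- cnj ?z)) (?C * Lambda_hat ?z) (0\<^sub>m 2 2)"
      unfolding Mh L by (subst mult_four_block_mat[of _ 2 2 _ 2 _ 2 _ _ 2 _ 2])
        (simp_all add: Lambda_hat_mat2 mat2_mult left_mult_zero_mat[of _ 2 2]
          left_add_zero_mat[of _ 2 2] right_add_zero_mat[of _ 2 2])
    have neg: "- four_block_mat (0\<^sub>m 2 2) ?B ?C (0\<^sub>m 2 2)
        = four_block_mat (0\<^sub>m 2 2) (- ?B) (- ?C) (0\<^sub>m 2 2)"
      by (rule eq_matI) auto
    have ?skew unfolding Mh neg
      by (subst transpose_four_block_mat[of _ 2 2 _ 2 _ 2]) (simp_all add: mat2_simps)
    moreover have ?sym unfolding prod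
      by (subst transpose_four_block_mat[of _ 2 2 _ 2 _ 2]) (simp_all add: mat2_simps algebra_simps)
    ultimately show ?thesis ..
  next
    case imag
    hence "M_hat_block m1 m2 \<alpha> \<beta> i = mat2 0 ?b (- ?b) 0"
      "Lambda_block m1 m2 \<mu> i = mat2 0 (Im ?z) (- Im ?z) 0"
      by (simp_all add: M_hat_block_def Lambda_block_def pick_range_def mat2_map
          mat2_J_mat mat2_smult)
    thus ?thesis by (simp add: mat2_simps)
  next
    case real
    hence "M_hat_block m1 m2 \<alpha> \<beta> i = mat2 0 ?b (- ?b) 0"
      "Lambda_block m1 m2 \<mu> i = mat2 ?z 0 0 (- ?z)"
      by (simp_all add: M_hat_block_def Lambda_block_def pick_range_def mat2_def[symmetric]
          mat2_J_mat mat2_smult)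
    thus ?thesis by (simp add: mat2_simps)
  qed
  thus ?skew and ?sym by auto
qed

text \<open>
  Each block is closed under negation, by an exchange of positions that depends only on the kind of
  the block. For imaginary pairs this needs \<open>cnj z = - z\<close>, that is, vanishing real part.
\<close>

lemma eigval_block_opposite:
  assumes "m1 < i \<Longrightarrow> i \<le> m2 \<Longrightarrow> Re (\<mu> i) = 0 \<and> Re (\<nu> i) = 0"
    and "(d, e) \<in> set (zip (eigval_block m1 m2 \<mu> i) (eigval_block m1 m2 \<nu> i))"
  shows "(- d, - e) \<in> set (zip (eigval_block m1 m2 \<mu> i) (eigval_block m1 m2 \<nu> i))"
proof -
  have "cnj z = - z" if "Re z = 0" for z using that by (simp add: complex_eq_iff)
  with assms show ?thesis
    by (auto simp: eigval_block_def pick_range_def split: if_splits)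
qed

section \<open>The assembled matrices\<close>

context
  fixes m1 m2 p q :: nat
  assumes m: "m1 \<le> m2" "m2 \<le> p" and q: "q = 2 * m1 + 2 * p"
begin

lemma X_mat_carrier: "X_mat N m1 m2 p x xh \<in> carrier_mat N q"
  using m unfolding X_mat_def three_ranges_def q
  by (auto simp: length_concat comp_def sum_list_triv simp del: upt_Suc)

lemma block_sum: "sum_list (map (block_size m1) [1..<p+1]) = q"
  unfolding q using m by (intro sum_block_size) simp

lemma Lambda_mat_blocks: "Lambda_mat m1 m2 p \<mu> = diag_block_mat (map (Lambda_block m1 m2 \<mu>) [1..<p+1])"
  and M_hat_blocks: "M_hat m1 m2 p \<alpha> \<beta> = diag_block_mat (map (M_hat_block m1 m2 \<alpha> \<beta>) [1..<p+1])"
  and eigenvalue_list_blocks: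
    "eigenvalue_list m1 m2 p \<mu> = concat (map (eigval_block m1 m2 \<mu>) [1..<p+1])"
  unfolding Lambda_mat_def M_hat_def eigenvalue_list_def Lambda_block_def M_hat_block_def
    eigval_block_def three_ranges_pick[OF m] by simp_all

lemma diag_blocks_carrier:
  assumes "\<And>i. F i \<in> carrier_mat (block_size m1 i) (block_size m1 i)"
  shows "diag_block_mat (map F [1..<p+1]) \<in> carrier_mat q q"
  unfolding block_sum[symmetric] by (rule diag_block_mat_carrier) (rule assms)

lemma Lambda_mat_carrier: "Lambda_mat m1 m2 p \<mu> \<in> carrier_mat q q"
  and M_hat_carrier: "M_hat m1 m2 p \<alpha> \<beta> \<in> carrier_mat q q"
  unfolding Lambda_mat_blocks M_hat_blocks by (rule diag_blocks_carrier, rule block_carriers)+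

lemma length_eigenvalue_list: "length (eigenvalue_list m1 m2 p \<mu>) = q"
  unfolding eigenvalue_list_blocks block_sum[symmetric]
  by (simp add: length_concat comp_def block_carriers(1) del: upt_Suc)

lemma M_hat_skew: "transpose_mat (M_hat m1 m2 p \<alpha> \<beta>) = - M_hat m1 m2 p \<alpha> \<beta>"
proof -
  have "transpose_mat (M_hat m1 m2 p \<alpha> \<beta>)
      = diag_block_mat (map (\<lambda>i. transpose_mat (M_hat_block m1 m2 \<alpha> \<beta> i)) [1..<p+1])"
    unfolding M_hat_blocks by (rule diag_block_mat_transpose) (rule block_carriers)
  also have "\<dots> = diag_block_mat (map (\<lambda>i. - M_hat_block m1 m2 \<alpha> \<beta> i) [1..<p+1])"
    using M_hat_block_symmetry(1)[of m1 _ m2 "\<lambda>_. 0"] by simp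
  also have "\<dots> = - M_hat m1 m2 p \<alpha> \<beta>" unfolding M_hat_blocks by (rule diag_block_mat_uminus)
  finally show ?thesis .
qed

lemma M_hat_Lambda_symmetric:
  assumes "\<And>k. k \<in> {m1+1..m2} \<Longrightarrow> Re (\<mu> k) = 0"
  shows "transpose_mat (M_hat m1 m2 p \<alpha> \<beta> * Lambda_mat m1 m2 p \<mu>)
       = M_hat m1 m2 p \<alpha> \<beta> * Lambda_mat m1 m2 p \<mu>"
proof -
  have prod: "M_hat m1 m2 p \<alpha> \<beta> * Lambda_mat m1 m2 p \<mu>
      = diag_block_mat (map (\<lambda>i. M_hat_block m1 m2 \<alpha> \<beta> i * Lambda_block m1 m2 \<mu> i) [1..<p+1])"
    unfolding M_hat_blocks Lambda_mat_blocks
    by (rule diag_block_mat_mult) (rule block_carriers)+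
  show ?thesis unfolding prod
    by (subst diag_block_mat_transpose[where s = "block_size m1"])
      (use assms in \<open>auto intro!: mult_carrier_mat block_carriers arg_cong[where f=diag_block_mat]
        M_hat_block_symmetry(2) simp del: upt_Suc\<close>)
qed

text \<open>
  The two eigenvalue matrices are diagonalised by the same block matrix \<open>P\<close>. Distinctness of the
  eigenvalues \<open>\<mu>\<close> ensures that two of them cancel only when they are a negated pair within one block, and
  then the corresponding two eigenvalues \<open>\<nu>\<close> cancel as well.
\<close>

lemma Lambda_mat_skew_adjoint_transfer:
  assumes re: "\<And>k. k \<in> {m1+1..m2} \<Longrightarrow> Re (\<mu> k) = 0 \<and> Re (\<nu> k) = 0"
    and dist: "distinct (eigenvalue_list m1 m2 p \<mu>)"
    and G: "G \<in> carrier_mat q q"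
    and skew: "transpose_mat (Lambda_mat m1 m2 p \<mu>) * G + G * Lambda_mat m1 m2 p \<mu> = 0\<^sub>m q q"
  shows "transpose_mat (Lambda_mat m1 m2 p \<nu>) * G + G * Lambda_mat m1 m2 p \<nu> = 0\<^sub>m q q"
proof -
  define P where "P = diag_block_mat (map (eigvec_block m1 m2) [1..<p+1])"
  define Q where "Q = diag_block_mat (map (eigvec_inv_block m1 m2) [1..<p+1])"
  have P: "P \<in> carrier_mat q q" and Q: "Q \<in> carrier_mat q q"
    unfolding P_def Q_def by (rule diag_blocks_carrier, rule block_carriers)+
  have "P * Q = diag_block_mat (map (\<lambda>i. 1\<^sub>m (block_size m1 i)) [1..<p+1])"
    unfolding P_def Q_def eigvec_block_inverse[of m1 m2, symmetric]
    by (rule diag_block_mat_mult) (rule block_carriers)+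
  hence PQ: "P * Q = 1\<^sub>m q" unfolding diag_block_mat_one block_sum .
  have diag: "Lambda_mat m1 m2 p \<xi> * P = P * mat_diag q (\<lambda>i. eigenvalue_list m1 m2 p \<xi> ! i)"
    if "\<And>k. k \<in> {m1+1..m2} \<Longrightarrow> Re (\<xi> k) = 0" for \<xi>
  proof -
    have D: "diag_of_list (eigval_block m1 m2 \<xi> i) \<in> carrier_mat (block_size m1 i) (block_size m1 i)" for i
      using diag_of_list_carrier[of "eigval_block m1 m2 \<xi> i"] unfolding block_carriers(1) .
    have "Lambda_mat m1 m2 p \<xi> * P
        = diag_block_mat (map (\<lambda>i. Lambda_block m1 m2 \<xi> i * eigvec_block m1 m2 i) [1..<p+1])"
      unfolding Lambda_mat_blocks P_def by (rule diag_block_mat_mult) (rule block_carriers)+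
    also have "\<dots> = diag_block_mat (map (\<lambda>i. eigvec_block m1 m2 i *
        diag_of_list (eigval_block m1 m2 \<xi> i)) [1..<p+1])"
      by (intro arg_cong[where f=diag_block_mat] map_cong refl Lambda_block_eigvecs)
        (auto intro: that)
    also have "\<dots> = P * diag_block_mat (map (\<lambda>i. diag_of_list (eigval_block m1 m2 \<xi> i)) [1..<p+1])"
      unfolding P_def by (rule diag_block_mat_mult[symmetric]) (rule block_carriers D)+
    also have "\<dots> = P * diag_of_list (eigenvalue_list m1 m2 p \<xi>)"
      unfolding diag_block_mat_diag_of_list eigenvalue_list_blocks ..
    finally show ?thesis unfolding diag_of_list_def length_eigenvalue_list .
  qed
  have closed: "(- d, - e) \<in> set (zip (eigenvalue_list m1 m2 p \<mu>) (eigenvalue_list m1 m2 p \<nu>))"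
    if "(d, e) \<in> set (zip (eigenvalue_list m1 m2 p \<mu>) (eigenvalue_list m1 m2 p \<nu>))" for d e
  proof -
    have zip: "zip (eigenvalue_list m1 m2 p \<mu>) (eigenvalue_list m1 m2 p \<nu>)
        = concat (map (\<lambda>i. zip (eigval_block m1 m2 \<mu> i) (eigval_block m1 m2 \<nu> i)) [1..<p+1])"
      unfolding eigenvalue_list_blocks by (rule zip_concat_map) (simp add: block_carriers(1))
    from that obtain i where i: "i \<in> set [1..<p+1]"
      and de: "(d, e) \<in> set (zip (eigval_block m1 m2 \<mu> i) (eigval_block m1 m2 \<nu> i))"
      unfolding zip set_concat set_map by blast
    have "(- d, - e) \<in> set (zip (eigval_block m1 m2 \<mu> i) (eigval_block m1 m2 \<nu> i))"
      by (rule eigval_block_opposite[OF _ de]) (simp add: re)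
    with i show ?thesis unfolding zip set_concat set_map by blast
  qed
  show ?thesis
  proof (rule skew_adjoint_transfer[OF _ _ G P Q PQ diag diag _ skew])
    fix u v assume "u < q" "v < q"
      "eigenvalue_list m1 m2 p \<mu> ! u + eigenvalue_list m1 m2 p \<mu> ! v = 0"
    thus "eigenvalue_list m1 m2 p \<nu> ! u + eigenvalue_list m1 m2 p \<nu> ! v = 0"
      using opposite_entries_transfer[OF dist _ closed] by (simp add: length_eigenvalue_list)
  qed (use re Lambda_mat_carrier in auto)
qed

end

section \<open>Structured eigenvalue replacement\<close>

theorem theorem7p4:
  fixes n m1 m2 p :: nat
    and M K Xc Xf \<Lambda>c \<Lambda>a \<Lambda>f :: "complex mat"
    and \<mu>c \<mu>a :: "nat \<Rightarrow> complex"
    and x xh :: "nat \<Rightarrow> complex vec"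
  assumes "real_mat M" and "real_mat K"
    and "T_SHH_pencil n M K"
    and "regular_pencil M K"
    and "m1 \<le> m2" and "m2 \<le> p" and "2 * m1 + 2 * p < 2 * n"
    and "\<And>j. j \<in> {1..m1} \<Longrightarrow> Re (\<mu>c j) \<noteq> 0 \<and> Im (\<mu>c j) \<noteq> 0 \<and> Re (\<mu>a j) \<noteq> 0 \<and> Im (\<mu>a j) \<noteq> 0"
    and "\<And>k. k \<in> {m1+1..m2} \<Longrightarrow> Re (\<mu>c k) = 0 \<and> Re (\<mu>a k) = 0"
    and "\<And>l. l \<in> {m2+1..p} \<Longrightarrow> Im (\<mu>c l) = 0 \<and> Im (\<mu>a l) = 0"
    and "\<And>j. j \<in> {1..m1} \<Longrightarrow> pencil_eigenpair (2*n) M K (\<mu>c j) (x j)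
                              \<and> pencil_eigenpair (2*n) M K (- cnj (\<mu>c j)) (xh j)"
    and "\<And>k. k \<in> {m1+1..m2} \<Longrightarrow> pencil_eigenpair (2*n) M K (\<mu>c k) (x k)"
    and "\<And>l. l \<in> {m2+1..p} \<Longrightarrow> pencil_eigenpair (2*n) M K (\<mu>c l) (x l) \<and> real_vec (x l)
                              \<and> pencil_eigenpair (2*n) M K (- \<mu>c l) (xh l) \<and> real_vec (xh l)"
    and "Xc = X_mat (2*n) m1 m2 p x xh"
    and "\<Lambda>c = Lambda_mat m1 m2 p \<mu>c"
    and "\<Lambda>a = Lambda_mat m1 m2 p \<mu>a"
    and "complementary_deflating_pairs (2*n) M K Xc \<Lambda>c Xf \<Lambda>f"
    and "spectrum \<Lambda>c \<inter> spectrum (- transpose_mat \<Lambda>f) = {}"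
    and "invertible_mat (G_mat n M Xc)"
    and "distinct (eigenvalue_list m1 m2 p \<mu>c)"
  shows "(\<forall>Mh \<in> carrier_mat (2*m1 + 2*p) (2*m1 + 2*p).
            complementary_deflating_pairs (2*n)
              (M + Delta_M n M Xc Mh) (K + Delta_K n M Xc \<Lambda>c \<Lambda>a Mh) Xc \<Lambda>a Xf \<Lambda>f)
       \<and> (\<forall>\<alpha> \<beta> :: nat \<Rightarrow> real.
            T_skew_Hamiltonian n (Delta_M n M Xc (M_hat m1 m2 p \<alpha> \<beta>)) \<and>
            T_Hamiltonian n (Delta_K n M Xc \<Lambda>c \<Lambda>a (M_hat m1 m2 p \<alpha> \<beta>)))"
proof -
  note SHH = assms(3) and m = assms(5,6) and imag = assms(9)
    and Xc = assms(14) and \<Lambda>c = assms(15) and \<Lambda>a = assms(16) and compl = assms(17)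
    and disj = assms(18) and inv = assms(19) and dist = assms(20)
  define q where "q = 2 * m1 + 2 * p"
  have X: "Xc \<in> carrier_mat (2*n) q" unfolding Xc by (rule X_mat_carrier[OF m q_def])
  have L: "Lambda_mat m1 m2 p \<mu> \<in> carrier_mat q q" for \<mu> by (rule Lambda_mat_carrier[OF m q_def])
  have defl_c: "deflating_pair (2*n) M K Xc \<Lambda>c" and defl_f: "deflating_pair (2*n) M K Xf \<Lambda>f"
    and nonsing: "invertible_mat (mat_of_cols (2*n) (cols Xc @ cols Xf))"
    using compl unfolding complementary_deflating_pairs_def by auto
  from defl_c X have q: "q \<le> 2*n" and rank: "vec_space.rank (2*n) Xc = q"
    and eq_c: "M * Xc * \<Lambda>c + K * Xc = 0\<^sub>m (2*n) q"
    unfolding deflating_pair_def by auto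
  from defl_f obtain r where f: "r \<le> 2*n" "Xf \<in> carrier_mat (2*n) r" "\<Lambda>f \<in> carrier_mat r r"
    "vec_space.rank (2*n) Xf = r" and eq_f: "M * Xf * \<Lambda>f + K * Xf = 0\<^sub>m (2*n) r"
    unfolding deflating_pair_def by auto
  interpret structured_deflating_pair n q M K Xc \<Lambda>c
    using SHH X L[of \<mu>c] eq_c inv unfolding T_SHH_pencil_def \<Lambda>c by unfold_locales auto
  have La: "\<Lambda>a \<in> carrier_mat q q" unfolding \<Lambda>a by (rule L)
  have "complementary_deflating_pairs (2*n)
      (M + Delta_M n M Xc Mh) (K + Delta_K n M Xc \<Lambda>c \<Lambda>a Mh) Xc \<Lambda>a Xf \<Lambda>f"
    if Mh: "Mh \<in> carrier_mat q q" for Mh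
  proof -
    note UY = U_complement[OF f(2,3) eq_f disj]
    have "(M + Delta_M n M Xc Mh) * Xf * \<Lambda>f + (K + Delta_K n M Xc \<Lambda>c \<Lambda>a Mh) * Xf = 0\<^sub>m (2*n) r"
      unfolding updated_pencil_agrees_on_complement[OF Mh La f(2) UY] by (rule eq_f)
    with updated_pair_deflates[OF Mh La] show ?thesis
      unfolding complementary_deflating_pairs_def deflating_pair_def
      using q rank X La f nonsing by blast
  qed
  moreover have "T_skew_Hamiltonian n (Delta_M n M Xc (M_hat m1 m2 p \<alpha> \<beta>)) \<and>
      T_Hamiltonian n (Delta_K n M Xc \<Lambda>c \<Lambda>a (M_hat m1 m2 p \<alpha> \<beta>))" for \<alpha> \<beta> :: "nat \<Rightarrow> real"
  proof
    note Mh = M_hat_carrier[OF m q_def, of \<alpha> \<beta>]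
    show "T_skew_Hamiltonian n (Delta_M n M Xc (M_hat m1 m2 p \<alpha> \<beta>))"
      by (rule Delta_M_skew_Hamiltonian[OF Mh La M_hat_skew[OF m q_def]])
    have "transpose_mat \<Lambda>c * G + G * \<Lambda>c = 0\<^sub>m q q"
      using skew_adjoint_iff_symmetric[OF \<Lambda>] G_\<Lambda>_symmetric by simp
    hence "transpose_mat \<Lambda>a * G + G * \<Lambda>a = 0\<^sub>m q q"
      using Lambda_mat_skew_adjoint_transfer[OF m q_def imag dist G_carrier] unfolding \<Lambda>c \<Lambda>a by blast
    hence "transpose_mat (G * \<Lambda>a) = G * \<Lambda>a"
      using skew_adjoint_iff_symmetric[OF La] by simp
    moreover have "transpose_mat (M_hat m1 m2 p \<alpha> \<beta> * \<Lambda>a) = M_hat m1 m2 p \<alpha> \<beta> * \<Lambda>a"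
      unfolding \<Lambda>a by (rule M_hat_Lambda_symmetric[OF m q_def]) (use imag in auto)
    ultimately show "T_Hamiltonian n (Delta_K n M Xc \<Lambda>c \<Lambda>a (M_hat m1 m2 p \<alpha> \<beta>))"
      by (rule Delta_K_Hamiltonian[OF Mh La])
  qed
  ultimately show ?thesis unfolding q_def by blast
qed

end
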